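(* For every $\epsilon>0$ and every finite nonempty set $A\subset\mathbb{H}\setminus\{0\}$, \[ |A+A| \gtrsim_\epsilon \frac{|A|^{14/9-\epsilon}}{d_*(A)^{5/9}}. \]
   Context: $\mathbb{H}$ denotes the quaternions; $A+A=\{a+b:a,b\in A\}$. For finite nonempty $A\subset\mathbb{H}\setminus\{0\}$, $d_*(A)=\min_{t>0}\min_{Q,R}|Q|^2|R|^2/(|A|t^3)$, the inner minimum over finite nonempty $Q,R\subset\mathbb{H}\setminus\{0\}$ with $\max\{|Q|,|R|\}\ge|A|$ and $|Q\cap Rx|\ge t$ for all $x\in A$, where $Rx=\{rx:r\in R\}$. $X\gtrsim_\epsilon Y$ means $X\ge c_\epsilon Y/(\log |A|)^{c}$ for an absolute constant $c$ and a constant $c_\epsilon>0$ depending only on $\epsilon$. *)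

theory Defs
  imports Complex_Main
begin

datatype quat = Quat (Re: real) (Im1: real) (Im2: real) (Im3: real)

instantiation quat :: "{zero, one, plus, times}"
begin
definition zero_quat_def: "0 = Quat 0 0 0 0"
definition one_quat_def: "1 = Quat 1 0 0 0"
definition plus_quat_def:
  "x + y = Quat (Re x + Re y) (Im1 x + Im1 y) (Im2 x + Im2 y) (Im3 x + Im3 y)"
definition times_quat_def:
  "x * y = Quat
     (Re x * Re y - Im1 x * Im1 y - Im2 x * Im2 y - Im3 x * Im3 y)
     (Re x * Im1 y + Im1 x * Re y + Im2 x * Im3 y - Im3 x * Im2 y)
     (Re x * Im2 y - Im1 x * Im3 y + Im2 x * Re y + Im3 x * Im1 y)
     (Re x * Im3 y + Im1 x * Im2 y - Im2 x * Im1 y + Im3 x * Re y)"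
instance ..
end

definition sumset :: "quat set \<Rightarrow> quat set \<Rightarrow> quat set" where
  "sumset A B = {a + b | a b. a \<in> A \<and> b \<in> B}"

definition rtrans :: "quat set \<Rightarrow> quat \<Rightarrow> quat set" where
  "rtrans R x = (\<lambda>r. r * x) ` R"

definition dstar_vals :: "quat set \<Rightarrow> real set" where
  "dstar_vals A = {real (card Q) ^ 2 * real (card R) ^ 2 / (real (card A) * t ^ 3) | t Q R.
      t > 0 \<and> finite Q \<and> Q \<noteq> {} \<and> 0 \<notin> Q \<and> finite R \<and> R \<noteq> {} \<and> 0 \<notin> R \<and>
      max (card Q) (card R) \<ge> card A \<and>
      (\<forall>x\<in>A. real (card (Q \<inter> rtrans R x)) \<ge> t)}"

text \<open>d_*(A): the minimum (infimum; it is attained) of these values.\<close>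
definition dstar :: "quat set \<Rightarrow> real" where
  "dstar A = Inf (dstar_vals A)"

end

theory Submission
  imports Defs "HOL-Analysis.Topology_Euclidean_Space" "HOL-Analysis.Harmonic_Numbers"
begin

text \<open>
  Left multiplications are similarities, so nearest neighbours among the points of a Cartesian
  product on a line \<open>q = r (s + b)\<close> are nearest neighbours in both coordinates. In a Euclidean space
  a point lies in boundedly many nearest-neighbour balls, hence most points of a rich line have a
  neighbour on it that is close in the counting sense in both coordinates; counting such pairs gives
  a Szemeredi--Trotter bound without any loss. With \<open>V = O(d\<^sub>*(A))\<close> it yields at most
  \<open>V |A| |B|\<^sup>2 / j\<^sup>3\<close> differences with at least \<open>j\<close> representations in \<open>A - B\<close>, so third moments of
  representation functions are \<open>O(V |A| |B|\<^sup>2 log |A|)\<close>. The Katz--Koester inclusion and Hoelder's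
  inequality bound the additive energy of \<open>A\<close> by such moments, following Schoen and Shkredov's
  argument for sums of convex sets.
\<close>

section \<open>Incidences in Cartesian products\<close>

text \<open>In the triangle 0, \<open>a\<close>, \<open>b\<close> the side opposite 0 is a longest
  one, so the angle at 0 is at least 60 degrees: twice the inner product is at most the smaller
  squared norm, hence at most the product of the norms.\<close>

lemma norm_diff_sgn_ge_1:
  fixes a b :: "'a::real_inner"
  assumes "a \<noteq> 0" "b \<noteq> 0" "norm a \<le> norm (a - b)" "norm b \<le> norm (a - b)"
  shows "1 \<le> norm (sgn a - sgn b)"
proof -
  have sq: "(norm (x - y))\<^sup>2 = (norm x)\<^sup>2 + (norm y)\<^sup>2 - 2 * (x \<bullet> y)" for x y :: 'a
    by (simp add: power2_norm_eq_inner inner_diff inner_commute)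
  have "(norm a)\<^sup>2 \<le> (norm (a - b))\<^sup>2" "(norm b)\<^sup>2 \<le> (norm (a - b))\<^sup>2"
    using assms by (auto intro: power_mono)
  then have "2 * (a \<bullet> b) \<le> (norm a)\<^sup>2" "2 * (a \<bullet> b) \<le> (norm b)\<^sup>2"
    unfolding sq by auto
  moreover have "min ((norm a)\<^sup>2) ((norm b)\<^sup>2) \<le> norm a * norm b"
    by (cases "norm a \<le> norm b")
       (auto simp: power2_eq_square min_le_iff_disj intro: mult_left_mono mult_right_mono)
  ultimately have "2 * (a \<bullet> b) \<le> norm a * norm b"
    by (auto simp: min_def split: if_splits)
  then have "2 * (sgn a \<bullet> sgn b) \<le> 1"
    using assms by (simp add: sgn_div_norm field_simps)
  then have "1 \<le> (norm (sgn a - sgn b))\<^sup>2"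
    unfolding sq using assms by (simp add: norm_sgn)
  then show ?thesis
    by (metis abs_norm_cancel abs_square_less_1 not_less)
qed

text \<open>The inequality puts \<open>p\<close> in the closed ball about \<open>x\<close> that
  reaches the nearest neighbour of \<open>x\<close>, so \<open>K\<close> bounds the overlap of such
  balls. Being purely metric, the notion transfers along isometric embeddings; the
  \<open>itself\<close> argument selects the type.\<close>

definition kissing_bound :: "'a::metric_space itself \<Rightarrow> nat \<Rightarrow> bool" where
  "kissing_bound _ K \<longleftrightarrow> (\<forall>(Z::'a set) p. finite Z \<longrightarrow>
     card {x\<in>Z. \<forall>y\<in>Z. y \<noteq> x \<longrightarrow> dist p x \<le> dist x y} \<le> K)"

text \<open>Seen from \<open>p\<close>, two distinct centres other than \<open>p\<close> have
  directions at distance at least 1, so each ball of radius 1/2 in a finite cover of the unit sphere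
  receives at most one of them.\<close>

lemma ex_kissing_bound: "\<exists>K. kissing_bound TYPE('a::euclidean_space) K"
proof -
  obtain C :: "'a set" where C: "finite C" "sphere 0 1 \<subseteq> (\<Union>c\<in>C. ball c (1/2))"
    using compact_imp_seq_compact[OF compact_sphere, of "0::'a" 1]
      seq_compact_imp_totally_bounded[of "sphere (0::'a) 1"]
    by (metis zero_less_divide_1_iff zero_less_numeral)
  \<comment> \<open>The extra 1 allows for \<open>x = p\<close>, which has no direction from
    \<open>p\<close>.\<close>
  have "card {x\<in>Z. \<forall>y\<in>Z. y \<noteq> x \<longrightarrow> dist p x \<le> dist x y} \<le> card C + 1"
    if "finite Z" for Z :: "'a set" and p
  proof -
    define W where "W = {x\<in>Z. \<forall>y\<in>Z. y \<noteq> x \<longrightarrow> dist p x \<le> dist x y}"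
    have "finite W" using that by (simp add: W_def)
    have "\<exists>c\<in>C. dist c (sgn (x - p)) < 1/2" if "x \<in> W - {p}" for x
    proof -
      have "sgn (x - p) \<in> sphere 0 1" using that by (simp add: norm_sgn)
      then show ?thesis using C(2) by (auto simp: subset_iff)
    qed
    then obtain g where g: "\<And>x. x \<in> W - {p} \<Longrightarrow> g x \<in> C \<and> dist (g x) (sgn (x - p)) < 1/2"
      by metis
    have "inj_on g (W - {p})"
    proof (rule inj_onI, rule ccontr)
      fix x y assume xy: "x \<in> W - {p}" "y \<in> W - {p}" "g x = g y" "x \<noteq> y"
      have "dist p x \<le> dist x y" "dist p y \<le> dist y x" using xy by (auto simp: W_def)
      then have "1 \<le> norm (sgn (x - p) - sgn (y - p))"
        using xy by (intro norm_diff_sgn_ge_1) (auto simp: dist_norm norm_minus_commute)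
      moreover have "dist (sgn (x - p)) (sgn (y - p)) < 1/2 + 1/2"
        using g[OF xy(1)] g[OF xy(2)] xy(3) dist_triangle_half_r[of "g x" _ 1] by simp
      ultimately show False by (simp add: dist_norm)
    qed
    then have "card (W - {p}) \<le> card C"
      using g C(1) by (intro card_inj_on_le[of g]) auto
    moreover have "card W \<le> card (W - {p}) + 1"
    proof -
      have "card W \<le> card (insert p (W - {p}))" using \<open>finite W\<close> by (intro card_mono) auto
      also have "\<dots> \<le> card (W - {p}) + 1"
        using \<open>finite W\<close> by (subst card_insert_if) (auto simp del: card_Diff_insert)
      finally show ?thesis .
    qed
    ultimately show ?thesis by (simp add: W_def)
  qed
  then show ?thesis unfolding kissing_bound_def by blast
qed

lemma kissing_bound_pos:
  assumes "kissing_bound TYPE('a::metric_space) K"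
  shows "0 < K"
proof -
  have "card {x\<in>{p}. \<forall>y\<in>{p}. y \<noteq> x \<longrightarrow> dist p x \<le> dist x y} \<le> K" for p :: 'a
    using assms unfolding kissing_bound_def by blast
  then show ?thesis by (simp add: Collect_conv_if)
qed

section \<open>Counting nearest-neighbour pairs along rich lines\<close>

lemma sum_card_swap:
  assumes "finite A" "finite B"
  shows "(\<Sum>a\<in>A. card {b\<in>B. P a b}) = (\<Sum>b\<in>B. card {a\<in>A. P a b})"
proof -
  have "(\<Sum>a\<in>A. card {b\<in>B. P a b}) = (\<Sum>a\<in>A. \<Sum>b\<in>B. if P a b then 1 else 0)"
    using assms by (simp add: sum.If_cases Int_def)
  also have "\<dots> = (\<Sum>b\<in>B. \<Sum>a\<in>A. if P a b then 1 else 0)"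
    by (rule sum.swap)
  also have "\<dots> = (\<Sum>b\<in>B. card {a\<in>A. P a b})"
    using assms by (simp add: sum.If_cases Int_def)
  finally show ?thesis .
qed

text \<open>Double counting: each \<open>z\<close> lies in at most \<open>K\<close> of the balls.
  Centres are indexed through an injection \<open>g\<close>, so that the bound serves both for the
  points of a line and for their images.\<close>

lemma sum_card_balls_le:
  fixes g :: "'i \<Rightarrow> 'a::metric_space"
  assumes K: "kissing_bound TYPE('a) K" and "finite T" "finite X" "inj_on g T"
    and \<rho>: "\<And>i j. i \<in> T \<Longrightarrow> j \<in> T \<Longrightarrow> i \<noteq> j \<Longrightarrow> \<rho> i \<le> dist (g i) (g j)"
  shows "(\<Sum>i\<in>T. card {z\<in>X. dist (g i) z \<le> \<rho> i}) \<le> K * card X"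
proof -
  have "(\<Sum>i\<in>T. card {z\<in>X. dist (g i) z \<le> \<rho> i}) = (\<Sum>z\<in>X. card {i\<in>T. dist (g i) z \<le> \<rho> i})"
    using assms by (intro sum_card_swap)
  also have "\<dots> \<le> (\<Sum>z\<in>X. K)"
  proof (rule sum_mono)
    fix z
    have "card {i\<in>T. dist (g i) z \<le> \<rho> i} = card (g ` {i\<in>T. dist (g i) z \<le> \<rho> i})"
      using assms(4) by (intro card_image[symmetric]) (auto simp: inj_on_def)
    also have "\<dots> \<le> card {x\<in>g`T. \<forall>y\<in>g`T. y \<noteq> x \<longrightarrow> dist z x \<le> dist x y}"
      using assms(2) \<rho> by (intro card_mono) (fastforce simp: dist_commute)+
    also have "\<dots> \<le> K"
      using K assms(2) unfolding kissing_bound_def by blast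
    finally show "card {i\<in>T. dist (g i) z \<le> \<rho> i} \<le> K" .
  qed
  finally show ?thesis by (simp add: mult.commute)
qed

text \<open>Markov's inequality. The factor 4 allows two such exceptional sets to be discarded while
  half of \<open>T\<close> remains.\<close>

lemma card_crowded_balls_le:
  fixes g :: "'i \<Rightarrow> 'a::metric_space"
  assumes K: "kissing_bound TYPE('a) K" and "finite T" "T \<noteq> {}" "finite X" "g ` T \<subseteq> X" "inj_on g T"
    and \<rho>: "\<And>i j. i \<in> T \<Longrightarrow> j \<in> T \<Longrightarrow> i \<noteq> j \<Longrightarrow> \<rho> i \<le> dist (g i) (g j)"
    and M: "4 * real K * real (card X) / real (card T) \<le> M"
  shows "real (card {i\<in>T. M < real (card {z\<in>X. dist (g i) z \<le> \<rho> i})}) \<le> real (card T) / 4"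
proof -
  define B where "B = {i\<in>T. M < real (card {z\<in>X. dist (g i) z \<le> \<rho> i})}"
  have "X \<noteq> {}" using assms(3,5) by auto
  then have pos: "0 < real (card X)" "0 < real K" "0 < real (card T)"
    using assms kissing_bound_pos[OF K] by (auto simp: card_gt_0_iff)
  have "(4 * real K * real (card X) / real (card T)) * real (card B) \<le> M * real (card B)"
    using M by (intro mult_right_mono) auto
  also have "\<dots> = (\<Sum>i\<in>B. M)" by simp
  also have "\<dots> \<le> (\<Sum>i\<in>B. real (card {z\<in>X. dist (g i) z \<le> \<rho> i}))"
    by (intro sum_mono) (auto simp: B_def)
  also have "\<dots> \<le> (\<Sum>i\<in>T. real (card {z\<in>X. dist (g i) z \<le> \<rho> i}))"
    using assms(2) by (intro sum_mono2) (auto simp: B_def)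
  also have "\<dots> = real (\<Sum>i\<in>T. card {z\<in>X. dist (g i) z \<le> \<rho> i})" by simp
  also have "\<dots> \<le> real (K * card X)"
    unfolding of_nat_le_iff by (rule sum_card_balls_le[OF K assms(2,4,6)]) (rule \<rho>)
  finally have "4 * (real K * real (card X)) * real (card B) \<le> (real K * real (card X)) * real (card T)"
    using pos by (simp add: field_simps)
  then have "4 * real (card B) \<le> real (card T)"
    using pos by (simp add: mult.commute mult.left_commute)
  then show ?thesis by (simp add: B_def)
qed

text \<open>Nearness is measured by rank within \<open>X\<close>, not by length; this bounds the
  number of close pairs however \<open>X\<close> is distributed.\<close>

definition close_points :: "'a::metric_space set \<Rightarrow> real \<Rightarrow> 'a \<Rightarrow> 'a set" where
  "close_points X M x = {y\<in>X. real (card {z\<in>X. dist x z \<le> dist x y}) \<le> M}"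

text \<open>All close points lie in the ball reaching to a farthest one, found below by minimising
  the negated distance, and that ball holds at most \<open>M\<close> points.\<close>

lemma card_close_points_le:
  assumes "finite X" "0 \<le> M"
  shows "real (card (close_points X M x)) \<le> M"
proof (cases "close_points X M x = {}")
  case False
  have fin: "finite (close_points X M x)" using assms by (simp add: close_points_def)
  define y where "y = arg_min_on (\<lambda>y. - dist x y) (close_points X M x)"
  have y: "y \<in> close_points X M x" "\<And>z. z \<in> close_points X M x \<Longrightarrow> dist x z \<le> dist x y"
    using arg_min_if_finite[OF fin False, of "\<lambda>y. - dist x y"] unfolding y_def by (auto simp: not_less)
  have "card (close_points X M x) \<le> card {z\<in>X. dist x z \<le> dist x y}"
    using assms y(2) by (intro card_mono) (auto simp: close_points_def)
  also have "real \<dots> \<le> M" using y(1) by (simp add: close_points_def)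
  finally show ?thesis by simp
qed (use assms in auto)

lemma card_Sigma_close_points_le:
  assumes "finite X" "0 \<le> M"
  shows "real (card (SIGMA x:X. close_points X M x)) \<le> real (card X) * M"
proof -
  have "real (card (SIGMA x:X. close_points X M x)) = (\<Sum>x\<in>X. real (card (close_points X M x)))"
    using assms by (subst card_SigmaI) (auto simp: close_points_def)
  also have "\<dots> \<le> (\<Sum>x\<in>X. M)" by (intro sum_mono card_close_points_le assms)
  finally show ?thesis by simp
qed

text \<open>Since \<open>f\<close> scales all distances by \<open>c\<close>, a nearest neighbour of
  \<open>x\<close> within \<open>T\<close> maps to a nearest neighbour of \<open>f x\<close> within
  the image of \<open>T\<close>. Each of the two rank conditions then fails on at most a quarter of
  \<open>T\<close>.\<close>

lemma many_close_pairs_on_line: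
  fixes f :: "'a::metric_space \<Rightarrow> 'a"
  assumes K: "kissing_bound TYPE('a) K" and fin: "finite X" "finite Y"
    and sim: "0 < c" "\<And>x y. dist (f x) (f y) = c * dist x y"
    and T: "T = {x\<in>X. f x \<in> Y}" "2 \<le> card T"
    and M: "4 * real K * real (card X) / real (card T) \<le> M"
           "4 * real K * real (card Y) / real (card T) \<le> M'"
  shows "\<exists>n. real (card T) / 2 \<le> real (card {x\<in>T. n x \<in> T \<and> n x \<noteq> x \<and>
             n x \<in> close_points X M x \<and> f (n x) \<in> close_points Y M' (f x)})"
proof -
  have finT: "finite T" using fin T(1) by simp
  have neT: "T \<noteq> {}" using T(2) by auto
  have "\<exists>y. y \<in> T \<and> y \<noteq> x \<and> (\<forall>z\<in>T. z \<noteq> x \<longrightarrow> dist x y \<le> dist x z)" if "x \<in> T" for x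
  proof -
    have "T - {x} \<noteq> {}"
    proof
      assume "T - {x} = {}"
      then have "card T \<le> card {x}" by (intro card_mono) auto
      with T(2) show False by simp
    qed
    then obtain y where "y \<in> T - {x}" "\<And>z. z \<in> T - {x} \<Longrightarrow> dist x y \<le> dist x z"
      using arg_min_if_finite[of "T - {x}" "dist x"] finT by (auto simp: not_less)
    then show ?thesis by blast
  qed
  then obtain n where n: "\<And>x. x \<in> T \<Longrightarrow> n x \<in> T \<and> n x \<noteq> x \<and> (\<forall>z\<in>T. z \<noteq> x \<longrightarrow> dist x (n x) \<le> dist x z)"
    by metis
  have inj: "inj f"
  proof (rule injI)
    fix x y assume "f x = f y"
    then have "c * dist x y = 0" using sim(2)[of x y] by simp
    then show "x = y" using sim(1) by simp
  qed
  define B1 where "B1 = {x\<in>T. M < real (card {z\<in>X. dist (id x) z \<le> dist x (n x)})}"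
  define B2 where "B2 = {x\<in>T. M' < real (card {z\<in>Y. dist (f x) z \<le> dist (f x) (f (n x))})}"
  have B1: "real (card B1) \<le> real (card T) / 4"
    unfolding B1_def using n T(1) by (intro card_crowded_balls_le[OF K finT neT fin(1) _ _ _ M(1)]) auto
  have B2: "real (card B2) \<le> real (card T) / 4"
    unfolding B2_def using n T(1) sim
    by (intro card_crowded_balls_le[OF K finT neT fin(2) _ _ _ M(2)] inj_on_subset[OF inj]) auto
  have "T - (B1 \<union> B2) \<subseteq> {x\<in>T. n x \<in> T \<and> n x \<noteq> x \<and>
      n x \<in> close_points X M x \<and> f (n x) \<in> close_points Y M' (f x)}" (is "_ \<subseteq> ?G")
    using n T(1) by (auto simp: B1_def B2_def close_points_def not_less)
  then have "card (T - (B1 \<union> B2)) \<le> card ?G"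
    using finT by (intro card_mono) auto
  moreover have "card T - card (B1 \<union> B2) \<le> card (T - (B1 \<union> B2))"
    using finT by (intro diff_card_le_card_Diff) (auto simp: B1_def B2_def)
  moreover have "card (B1 \<union> B2) \<le> card B1 + card B2" by (rule card_Un_le)
  ultimately have "real (card T) \<le> real (card ?G) + real (card B1) + real (card B2)"
    by linarith
  then show ?thesis using B1 B2 by (intro exI[of _ n]) linarith
qed

text \<open>Lines with at least half the average number \<open>k\<close> of incidences carry at
  least half of \<open>I\<close>, and on each of them at least half of the points have a neighbour
  close in both coordinates. The lower bound on \<open>I\<close> guarantees at least two points on
  each such line.\<close>

lemma cartesian_incidence_bound:
  fixes f :: "'l \<Rightarrow> 'a::metric_space \<Rightarrow> 'a"
  assumes K: "kissing_bound TYPE('a) K" and fin: "finite X" "finite Y" "finite L"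
    and sim: "\<And>l. l \<in> L \<Longrightarrow> \<exists>c>0. \<forall>x y. dist (f l x) (f l y) = c * dist x y"
    and det: "\<And>l m x y. l \<in> L \<Longrightarrow> m \<in> L \<Longrightarrow> x \<noteq> y \<Longrightarrow> f l x = f m x \<Longrightarrow> f l y = f m y \<Longrightarrow> l = m"
    and I: "I = (\<Sum>l\<in>L. real (card {x\<in>X. f l x \<in> Y}))" "4 * real (card L) \<le> I"
  shows "I ^ 3 \<le> 256 * (real K)\<^sup>2 * (real (card X))\<^sup>2 * (real (card Y))\<^sup>2 * (real (card L))\<^sup>2"
proof (cases "L = {}")
  case True
  then show ?thesis using I by simp
next
  case False
  define T where "T l = {x\<in>X. f l x \<in> Y}" for l
  define k where "k = I / real (card L)"
  have Lpos: "0 < real (card L)" using False fin by (simp add: card_gt_0_iff)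
  then have k: "4 \<le> k" using I(2) by (simp add: k_def field_simps)
  \<comment> \<open>On \<open>L'\<close> the count \<open>card (T l)\<close> is at least
    \<open>k / 2\<close>, which turns the constant 4 of the single-line bound into a uniform
    8.\<close>
  define M where "M = 8 * real K * real (card X) / k"
  define M' where "M' = 8 * real K * real (card Y) / k"
  define L' where "L' = {l\<in>L. k / 2 \<le> real (card (T l))}"
  have finL': "finite L'" using fin by (simp add: L'_def)
  have nonneg: "0 \<le> M" "0 \<le> M'" using k by (auto simp: M_def M'_def)
  have "\<exists>n. real (card (T l)) / 2 \<le> real (card {x\<in>T l. n x \<in> T l \<and> n x \<noteq> x \<and>
             n x \<in> close_points X M x \<and> f l (n x) \<in> close_points Y M' (f l x)})" if l: "l \<in> L'" for l
  proof -
    from l obtain c where c: "c > 0" "\<And>x y. dist (f l x) (f l y) = c * dist x y"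
      using sim[of l] by (auto simp: L'_def)
    have big: "k / 2 \<le> real (card (T l))" using l by (simp add: L'_def)
    have le: "4 * real K * r / real (card (T l)) \<le> 8 * real K * r / k" if "0 \<le> r" for r
    proof -
      have "4 * real K * r / real (card (T l)) \<le> 4 * real K * r / (k / 2)"
        using big k that by (intro divide_left_mono mult_pos_pos) auto
      then show ?thesis by simp
    qed
    show ?thesis
      using le big k unfolding M_def M'_def
      by (intro many_close_pairs_on_line[OF K fin(1,2) c T_def]) auto
  qed
  then obtain n where n: "\<And>l. l \<in> L' \<Longrightarrow> real (card (T l)) / 2 \<le> real (card {x\<in>T l. n l x \<in> T l \<and> n l x \<noteq> x \<and>
             n l x \<in> close_points X M x \<and> f l (n l x) \<in> close_points Y M' (f l x)})"
    using bchoice[of L'] by meson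
  define G where "G l = {x\<in>T l. n l x \<in> T l \<and> n l x \<noteq> x \<and>
             n l x \<in> close_points X M x \<and> f l (n l x) \<in> close_points Y M' (f l x)}" for l
  have finG: "finite (G l)" for l using fin by (simp add: G_def T_def)
  have "I = (\<Sum>l\<in>L'. real (card (T l))) + (\<Sum>l\<in>L-L'. real (card (T l)))"
    unfolding I(1) T_def[symmetric] using fin
    by (subst sum.subset_diff[of L']) (auto simp: L'_def)
  moreover have "(\<Sum>l\<in>L-L'. real (card (T l))) \<le> I / 2"
  proof -
    have "(\<Sum>l\<in>L-L'. real (card (T l))) \<le> (\<Sum>l\<in>L-L'. k / 2)"
      by (intro sum_mono) (auto simp: L'_def)
    also have "\<dots> \<le> (\<Sum>l\<in>L. k / 2)" using fin k by (intro sum_mono2) auto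
    also have "\<dots> = I / 2" using Lpos by (simp add: k_def)
    finally show ?thesis .
  qed
  ultimately have "I / 4 \<le> (\<Sum>l\<in>L'. real (card (T l)) / 2)"
    by (simp add: sum_divide_distrib[symmetric])
  also have "\<dots> \<le> (\<Sum>l\<in>L'. real (card (G l)))"
    unfolding G_def by (intro sum_mono n)
  also have "\<dots> = real (card (SIGMA l:L'. G l))"
    using finL' finG by (subst card_SigmaI) auto
  also have "\<dots> \<le> real (card ((SIGMA x:X. close_points X M x) \<times> (SIGMA y:Y. close_points Y M' y)))"
  proof -
    \<comment> \<open>The points \<open>(x, f l x)\<close> and \<open>(n l x, f l (n l x))\<close>
      are distinct, so by \<open>det\<close> they determine \<open>l\<close>.\<close>
    have "inj_on (\<lambda>(l,x). ((x, n l x), (f l x, f l (n l x)))) (SIGMA l:L'. G l)"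
      by (rule inj_onI) (clarsimp simp: G_def L'_def, metis det)
    moreover have "(\<lambda>(l,x). ((x, n l x), (f l x, f l (n l x)))) ` (SIGMA l:L'. G l)
        \<subseteq> (SIGMA x:X. close_points X M x) \<times> (SIGMA y:Y. close_points Y M' y)"
      by (auto simp: G_def T_def)
    moreover have "finite ((SIGMA x:X. close_points X M x) \<times> (SIGMA y:Y. close_points Y M' y))"
      using fin by (auto simp: close_points_def)
    ultimately show ?thesis by (simp only: of_nat_le_iff card_inj_on_le)
  qed
  also have "\<dots> = real (card (SIGMA x:X. close_points X M x)) * real (card (SIGMA y:Y. close_points Y M' y))"
    by (simp add: card_cartesian_product)
  also have "\<dots> \<le> (real (card X) * M) * (real (card Y) * M')"
    using fin nonneg by (intro mult_mono card_Sigma_close_points_le) auto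
  also have "\<dots> = 64 * (real K)\<^sup>2 * (real (card X))\<^sup>2 * (real (card Y))\<^sup>2 / k\<^sup>2"
    by (simp add: M_def M'_def power2_eq_square)
  finally have "I * k\<^sup>2 \<le> 256 * (real K)\<^sup>2 * (real (card X))\<^sup>2 * (real (card Y))\<^sup>2"
    using k by (simp add: field_simps)
  then have "I * k\<^sup>2 * (real (card L))\<^sup>2 \<le> 256 * (real K)\<^sup>2 * (real (card X))\<^sup>2 * (real (card Y))\<^sup>2 * (real (card L))\<^sup>2"
    by (rule mult_right_mono) simp
  moreover have "I * k\<^sup>2 * (real (card L))\<^sup>2 = I ^ 3"
    using Lpos by (simp add: k_def power_divide power2_eq_square power3_eq_cube)
  ultimately show ?thesis by simp
qed

section \<open>Energy and sumsets\<close>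

definition diffset :: "'a::ab_group_add set \<Rightarrow> 'a set \<Rightarrow> 'a set" where
  "diffset A B = (\<lambda>(a, b). a - b) ` (A \<times> B)"

definition rep :: "'a::ab_group_add set \<Rightarrow> 'a set \<Rightarrow> 'a \<Rightarrow> nat" where
  "rep A B z = card {p \<in> A \<times> B. fst p - snd p = z}"

lemma finite_diffset [simp]: "finite A \<Longrightarrow> finite B \<Longrightarrow> finite (diffset A B)"
  by (simp add: diffset_def)

lemma rep_eq_card: "rep A B z = card {b\<in>B. z + b \<in> A}"
  unfolding rep_def
  by (rule bij_betw_same_card[of snd], rule bij_betw_byWitness[of _ "\<lambda>b. (z + b, b)"])
     (auto simp: algebra_simps)

lemma rep_le_card: "finite A \<Longrightarrow> finite B \<Longrightarrow> rep A B z \<le> card A"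
  unfolding rep_eq_card by (rule card_inj_on_le[of "\<lambda>b. z + b"]) auto

lemma rep_eq_0: "z \<notin> diffset A B \<Longrightarrow> rep A B z = 0"
  by (auto simp: rep_def diffset_def card_eq_0_iff)

lemma sum_card_fibres:
  assumes "finite P" "finite Z" "f ` P \<subseteq> Z"
  shows "(\<Sum>z\<in>Z. card {p\<in>P. f p = z}) = card P"
  using card_eq_sum sum.group[OF assms, of "\<lambda>_. 1::nat"] by simp

lemma sum_card_fibres_mult:
  assumes "finite P" "finite Q" "finite Z" "f ` P \<subseteq> Z"
  shows "(\<Sum>z\<in>Z. card {p\<in>P. f p = z} * card {q\<in>Q. g q = z}) = card {(p,q)\<in>P \<times> Q. f p = g q}"
proof -
  have "card {(p,q)\<in>P \<times> Q. f p = g q} = card (SIGMA z:Z. {p\<in>P. f p = z} \<times> {q\<in>Q. g q = z})"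
    using assms(4)
    by (intro bij_betw_same_card[of "\<lambda>(p,q). (f p, p, q)"] bij_betw_byWitness[of _ snd]) auto
  also have "\<dots> = (\<Sum>z\<in>Z. card {p\<in>P. f p = z} * card {q\<in>Q. g q = z})"
    using assms by (subst card_SigmaI) (auto simp: card_cartesian_product)
  finally show ?thesis by simp
qed

text \<open>Cauchy--Schwarz for the fibre sizes of \<open>f\<close>.\<close>

lemma card_squared_le_collisions:
  assumes "finite P" "finite Z" "f ` P \<subseteq> Z"
  shows "(card P)\<^sup>2 \<le> card Z * card {(p,q)\<in>P \<times> P. f p = f q}"
proof -
  have "(real (card P))\<^sup>2 = (\<Sum>z\<in>Z. 1 * real (card {p\<in>P. f p = z}))\<^sup>2"
    by (subst sum_card_fibres[OF assms, symmetric]) simp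
  also have "\<dots> \<le> (\<Sum>z\<in>Z. 1\<^sup>2) * (\<Sum>z\<in>Z. (real (card {p\<in>P. f p = z}))\<^sup>2)"
    by (rule Cauchy_Schwarz_ineq_sum)
  also have "\<dots> = real (card Z * card {(p,q)\<in>P \<times> P. f p = f q})"
    by (subst sum_card_fibres_mult[OF assms(1,1,2,3), symmetric]) (simp add: power2_eq_square)
  finally show ?thesis by (simp only: of_nat_power[symmetric] of_nat_le_iff)
qed

lemma sum_rep: "finite A \<Longrightarrow> finite B \<Longrightarrow> (\<Sum>z\<in>diffset A B. rep A B z) = card A * card B"
  unfolding rep_def
  by (subst sum_card_fibres) (auto simp: diffset_def card_cartesian_product case_prod_beta)

text \<open>Both sides are the additive energy of \<open>A\<close> and \<open>B\<close>: a - a' = b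
  - b' rearranges to a - b = a' - b'.\<close>

lemma sum_rep_mult_rep:
  assumes "finite A" "finite B"
  shows "(\<Sum>z\<in>diffset A A. rep A A z * rep B B z) = (\<Sum>z\<in>diffset A B. (rep A B z)\<^sup>2)"
proof -
  have "(\<Sum>z\<in>diffset A A. rep A A z * rep B B z)
      = card {(p,q) \<in> (A \<times> A) \<times> (B \<times> B). fst p - snd p = fst q - snd q}"
    unfolding rep_def using assms
    by (intro sum_card_fibres_mult) (auto simp: diffset_def case_prod_beta)
  also have "\<dots> = card {(p,q) \<in> (A \<times> B) \<times> (A \<times> B). fst p - snd p = fst q - snd q}"
    by (rule bij_betw_same_card[of "\<lambda>((a,a'),(b,b')). ((a,b),(a',b'))"],
        rule bij_betw_byWitness[of _ "\<lambda>((a,b),(a',b')). ((a,a'),(b,b'))"])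
       (auto simp: algebra_simps)
  also have "\<dots> = (\<Sum>z\<in>diffset A B. (rep A B z)\<^sup>2)"
    unfolding rep_def power2_eq_square using assms
    by (intro sum_card_fibres_mult[symmetric]) (auto simp: diffset_def case_prod_beta)
  finally show ?thesis .
qed

text \<open>Cauchy--Schwarz over the sums, followed by rearranging a + b = c + d to a - c = d -
  b.\<close>

lemma card_power4_le_energy:
  assumes "finite A"
  shows "card A ^ 4 \<le> card ((\<lambda>(a,b). a + b) ` (A \<times> A)) * (\<Sum>z\<in>diffset A A. (rep A A z)\<^sup>2)"
proof -
  have "card A ^ 4 = (card (A \<times> A))\<^sup>2"
    by (simp add: card_cartesian_product power2_eq_square eval_nat_numeral)
  also have "\<dots> \<le> card ((\<lambda>(a,b). a + b) ` (A \<times> A)) *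
      card {(p,q) \<in> (A \<times> A) \<times> (A \<times> A). (\<lambda>(a,b). a + b) p = (\<lambda>(a,b). a + b) q}"
    using assms by (intro card_squared_le_collisions) auto
  also have "card {(p,q) \<in> (A \<times> A) \<times> (A \<times> A). (\<lambda>(a,b). a + b) p = (\<lambda>(a,b). a + b) q}
      = card {(p,q) \<in> (A \<times> A) \<times> (A \<times> A). fst p - snd p = fst q - snd q}"
    by (rule bij_betw_same_card[of "\<lambda>((a,b),(c,d)). ((a,c),(d,b))"],
        rule bij_betw_byWitness[of _ "\<lambda>((a,c),(d,b)). ((a,b),(c,d))"])
       (auto simp: algebra_simps)
  also have "\<dots> = (\<Sum>z\<in>diffset A A. (rep A A z)\<^sup>2)"
    unfolding rep_def power2_eq_square using assms
    by (intro sum_card_fibres_mult[symmetric]) (auto simp: diffset_def case_prod_beta)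
  finally show ?thesis .
qed

text \<open>This is the additive energy of \<open>A\<close> with the fibre
  \<open>A \<inter> (A - s)\<close>.\<close>

definition fibre_energy :: "'a::ab_group_add set \<Rightarrow> 'a \<Rightarrow> nat" where
  "fibre_energy A s = card {(p,q) \<in> (A \<times> {b\<in>A. s + b \<in> A}) \<times> (A \<times> {b\<in>A. s + b \<in> A}).
     (\<lambda>(a,b). a + b) p = (\<lambda>(a,b). a + b) q}"

text \<open>The Katz--Koester inclusion: adding \<open>A\<close> to \<open>A \<inter> (A - s)\<close> lands in \<open>S \<inter> (S - s)\<close>
  for \<open>S = A + A\<close>.\<close>
lemma card_rep_squared_le_fibre_energy:
  assumes "finite A" and S: "S = (\<lambda>(a,b). a + b) ` (A \<times> A)"
  shows "(card A * rep A A s)\<^sup>2 \<le> rep S S s * fibre_energy A s"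
proof -
  define As where "As = {b\<in>A. s + b \<in> A}"
  have "finite S" using assms by simp
  have "(\<lambda>(a,b). a + b) ` (A \<times> As) \<subseteq> {x\<in>S. s + x \<in> S}"
  proof clarsimp
    fix a b assume ab: "a \<in> A" "b \<in> As"
    have "a + b \<in> S" using ab unfolding S As_def by force
    moreover have "s + (a + b) \<in> S"
      unfolding S using ab by (intro image_eqI[of _ _ "(a, s + b)"]) (auto simp: As_def algebra_simps)
    ultimately show "a + b \<in> S \<and> s + (a + b) \<in> S" ..
  qed
  then have "(card (A \<times> As))\<^sup>2 \<le> card {x\<in>S. s + x \<in> S} *
      card {(p,q) \<in> (A \<times> As) \<times> (A \<times> As). (\<lambda>(a,b). a + b) p = (\<lambda>(a,b). a + b) q}"
    using assms \<open>finite S\<close> by (intro card_squared_le_collisions) (auto simp: As_def)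
  then show ?thesis
    by (simp only: card_cartesian_product As_def fibre_energy_def rep_eq_card)
qed

text \<open>A solution of a + b = a' + b' counted at \<open>s\<close> gives three representations of
  one difference, a - a' = b' - b = (s + b') - (s + b), and these recover \<open>s\<close> and all
  four elements.\<close>

lemma sum_fibre_energy_le:
  assumes "finite A"
  shows "(\<Sum>s\<in>diffset A A. fibre_energy A s) \<le> (\<Sum>z\<in>diffset A A. rep A A z ^ 3)"
proof -
  let ?F = "\<lambda>s. {(p,q) \<in> (A \<times> {b\<in>A. s + b \<in> A}) \<times> (A \<times> {b\<in>A. s + b \<in> A}).
     (\<lambda>(a,b). a + b) p = (\<lambda>(a,b). a + b) q}"
  let ?P = "\<lambda>z. {p \<in> A \<times> A. fst p - snd p = z}"
  have "(\<Sum>s\<in>diffset A A. fibre_energy A s) = card (SIGMA s:diffset A A. ?F s)"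
    unfolding fibre_energy_def using assms
    by (intro card_SigmaI[symmetric] ballI finite_subset[of "?F _" "(A \<times> A) \<times> (A \<times> A)"]) auto
  also have "\<dots> \<le> card (SIGMA z:diffset A A. ?P z \<times> ?P z \<times> ?P z)"
  proof (rule card_inj_on_le)
    let ?h = "\<lambda>(s,(a,b),(a',b')). (a - a', (a, a'), (b', b), (s + b', s + b))"
    show "inj_on ?h (SIGMA s:diffset A A. ?F s)" by (auto simp: inj_on_def)
    show "?h ` (SIGMA s:diffset A A. ?F s) \<subseteq> (SIGMA z:diffset A A. ?P z \<times> ?P z \<times> ?P z)"
      by (auto simp: diffset_def algebra_simps)
    show "finite (SIGMA z:diffset A A. ?P z \<times> ?P z \<times> ?P z)" using assms by auto
  qed
  also have "\<dots> = (\<Sum>z\<in>diffset A A. rep A A z ^ 3)"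
    using assms by (subst card_SigmaI) (auto simp: card_cartesian_product rep_def power3_eq_cube mult.assoc)
  finally show ?thesis .
qed

text \<open>Write \<open>r = rep A A\<close>. The fibre energies give \<open>|A| \<Sum> r\<^bsup>3/2\<^esup> \<le> (E\<^sub>3 E(A,S))\<^bsup>1/2\<^esup>\<close>, and
  \<open>\<Sum> r\<^sup>2\<close> is interpolated between this sum and \<open>E\<^sub>3 = \<Sum> r\<^sup>3\<close>.\<close>
lemma energy_cubed_le:
  assumes "finite A" and S: "S = (\<lambda>(a,b). a + b) ` (A \<times> A)"
  shows "real (\<Sum>z\<in>diffset A A. (rep A A z)\<^sup>2) ^ 3 * (real (card A))\<^sup>2
      \<le> (real (\<Sum>z\<in>diffset A A. rep A A z ^ 3))\<^sup>2 * real (\<Sum>z\<in>diffset A S. (rep A S z)\<^sup>2)"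
proof -
  define N where "N = real (card A)"
  \<comment> \<open>Taking square roots makes half-integral moments of \<open>rep A A\<close>
    integral powers: \<open>F3\<close> and \<open>F5\<close> are the moments of order 3/2 and
    5/2.\<close>
  define r where "r z = sqrt (real (rep A A z))" for z
  define E2 E3 F3 F5 EAS where
    "E2 = (\<Sum>z\<in>diffset A A. r z ^ 4)" and "E3 = (\<Sum>z\<in>diffset A A. r z ^ 6)" and
    "F3 = (\<Sum>z\<in>diffset A A. r z ^ 3)" and "F5 = (\<Sum>z\<in>diffset A A. r z ^ 5)" and
    "EAS = (\<Sum>z\<in>diffset A A. (r z * sqrt (real (rep S S z)))\<^sup>2)"
  have r0: "0 \<le> r z" and r2: "r z ^ 2 = real (rep A A z)" for z by (auto simp: r_def)
  have r4: "r z ^ 4 = (real (rep A A z))\<^sup>2" and r6: "r z ^ 6 = real (rep A A z) ^ 3" for z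
    using r2[of z] power_mult[of "r z" 2 2] power_mult[of "r z" 2 3] by simp_all
  have finS: "finite S" using assms by simp
  have E2: "real (\<Sum>z\<in>diffset A A. (rep A A z)\<^sup>2) = E2" by (simp add: E2_def r4)
  have E3: "real (\<Sum>z\<in>diffset A A. rep A A z ^ 3) = E3" by (simp add: E3_def r6)
  have EAS: "real (\<Sum>z\<in>diffset A S. (rep A S z)\<^sup>2) = EAS"
    unfolding sum_rep_mult_rep[OF assms(1) finS, symmetric]
    by (simp add: EAS_def power_mult_distrib r2)
  have pos: "0 \<le> E2" "0 \<le> E3" "0 \<le> F3" "0 \<le> F5" "0 \<le> EAS" "0 \<le> N"
    by (auto simp: E2_def E3_def F3_def F5_def EAS_def N_def r0 intro!: sum_nonneg zero_le_power)
  \<comment> \<open>The square root of the Katz--Koester bound is weighted by \<open>r z\<close> to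
    prepare Cauchy--Schwarz: the squares of the first factor sum to \<open>EAS\<close>, those of the
    second to the total fibre energy.\<close>
  have "N * F3 \<le> (\<Sum>z\<in>diffset A A. (r z * sqrt (real (rep S S z))) * sqrt (real (fibre_energy A z)))"
    unfolding F3_def sum_distrib_left
  proof (rule sum_mono)
    fix z
    have "(N * r z ^ 2)\<^sup>2 \<le> real (rep S S z) * real (fibre_energy A z)"
      using card_rep_squared_le_fibre_energy[OF assms, of z]
      unfolding r2 N_def of_nat_mult[symmetric] of_nat_power[symmetric] of_nat_le_iff .
    then have "N * r z ^ 2 \<le> sqrt (real (rep S S z) * real (fibre_energy A z))"
      by (rule real_le_rsqrt)
    then have "r z * (N * r z ^ 2) \<le> r z * sqrt (real (rep S S z) * real (fibre_energy A z))"
      using r0 by (rule mult_left_mono)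
    then show "N * r z ^ 3 \<le> (r z * sqrt (real (rep S S z))) * sqrt (real (fibre_energy A z))"
      by (simp add: real_sqrt_mult power3_eq_cube power2_eq_square algebra_simps)
  qed
  then have "(N * F3)\<^sup>2 \<le> (\<Sum>z\<in>diffset A A. (r z * sqrt (real (rep S S z))) * sqrt (real (fibre_energy A z)))\<^sup>2"
    using pos by (intro power_mono) auto
  also have "\<dots> \<le> EAS * (\<Sum>z\<in>diffset A A. (sqrt (real (fibre_energy A z)))\<^sup>2)"
    unfolding EAS_def by (rule Cauchy_Schwarz_ineq_sum)
  also have "\<dots> \<le> EAS * E3"
    using sum_fibre_energy_le[OF assms(1)] pos unfolding E3[symmetric]
    by (intro mult_left_mono) (simp_all flip: of_nat_sum)
  finally have NF3: "(N * F3)\<^sup>2 \<le> EAS * E3" .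
  have "E2\<^sup>2 = (\<Sum>z\<in>diffset A A. (r z ^ 2 * r z ^ 2))\<^sup>2"
    by (simp add: E2_def power2_eq_square eval_nat_numeral mult_ac)
  have cs: "(\<Sum>z\<in>diffset A A. f z)\<^sup>2 \<le> (\<Sum>z\<in>diffset A A. g z) * (\<Sum>z\<in>diffset A A. h z)"
    if "\<And>z. 0 \<le> g z" "\<And>z. 0 \<le> h z" "\<And>z. 0 \<le> f z" "\<And>z. (f z)\<^sup>2 = g z * h z" for f g h :: "'a \<Rightarrow> real"
  proof -
    have "f z = sqrt (g z) * sqrt (h z)" for z
      by (metis that(3,4) real_sqrt_mult real_sqrt_unique)
    then show ?thesis
      using Cauchy_Schwarz_ineq_sum[of "\<lambda>z. sqrt (g z)" "\<lambda>z. sqrt (h z)" "diffset A A"] that by simp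
  qed
  \<comment> \<open>Log-convexity of moments: 2 is the midpoint of 3/2 and 5/2, and 5/2 that of 2
    and 3. Eliminating \<open>F5\<close> from the two inequalities bounds
    \<open>E2 ^ 3\<close>.\<close>
  have c1: "E2\<^sup>2 \<le> F3 * F5"
    unfolding E2_def F3_def F5_def by (rule cs) (auto simp: r0 power_mult[symmetric] power_add[symmetric])
  have c2: "F5\<^sup>2 \<le> E2 * E3"
    unfolding E2_def E3_def F5_def by (rule cs) (auto simp: r0 power_mult[symmetric] power_add[symmetric])
  have "E2 ^ 3 \<le> F3\<^sup>2 * E3"
  proof (cases "E2 = 0")
    case False
    have "E2 * E2 ^ 3 = (E2\<^sup>2)\<^sup>2" by (simp add: power2_eq_square eval_nat_numeral)
    also have "\<dots> \<le> (F3 * F5)\<^sup>2" using c1 by (intro power_mono) auto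
    also have "\<dots> \<le> F3\<^sup>2 * (E2 * E3)"
      unfolding power_mult_distrib using c2 by (intro mult_left_mono) auto
    finally have "E2 * E2 ^ 3 \<le> E2 * (F3\<^sup>2 * E3)" by (simp add: mult_ac)
    then show ?thesis using False pos by simp
  qed (use pos in simp)
  then have "E2 ^ 3 * N\<^sup>2 \<le> (F3\<^sup>2 * E3) * N\<^sup>2" by (rule mult_right_mono) simp
  also have "\<dots> = (N * F3)\<^sup>2 * E3" by (simp add: power_mult_distrib mult_ac)
  also have "\<dots> \<le> (EAS * E3) * E3" using NF3 pos by (intro mult_right_mono)
  finally show ?thesis
    unfolding E2 E3 EAS N_def by (simp add: power2_eq_square mult_ac)
qed

text \<open>Layer-cake summation: consecutive cubes differ by at most 3 j^2, so level
  \<open>j\<close> contributes at most 3 V / j, and the levels stop at \<open>N\<close>.\<close>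

lemma sum_cubes_le_harm:
  fixes r :: "'a \<Rightarrow> nat"
  assumes "finite Z" and N: "\<And>z. z \<in> Z \<Longrightarrow> r z \<le> N"
    and level: "\<And>j. j \<ge> 1 \<Longrightarrow> real (card {z\<in>Z. j \<le> r z}) \<le> V / real j ^ 3"
  shows "real (\<Sum>z\<in>Z. r z ^ 3) \<le> 3 * V * harm N"
proof -
  have cube: "real m ^ 3 \<le> (\<Sum>j=1..m. 3 * (real j)\<^sup>2)" for m
    by (induction m) (auto simp: power2_eq_square power3_eq_cube algebra_simps)
  have "real (\<Sum>z\<in>Z. r z ^ 3) = (\<Sum>z\<in>Z. real (r z) ^ 3)" by simp
  also have "\<dots> \<le> (\<Sum>z\<in>Z. \<Sum>j=1..N. if j \<le> r z then 3 * (real j)\<^sup>2 else 0)"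
  proof (rule sum_mono)
    fix z assume "z \<in> Z"
    then have "{1..N} \<inter> {j. j \<le> r z} = {1..r z}" using N[of z] by auto
    then show "real (r z) ^ 3 \<le> (\<Sum>j=1..N. if j \<le> r z then 3 * (real j)\<^sup>2 else 0)"
      using cube[of "r z"] by (simp add: sum.If_cases)
  qed
  also have "\<dots> = (\<Sum>j=1..N. \<Sum>z\<in>Z. if j \<le> r z then 3 * (real j)\<^sup>2 else 0)"
    by (rule sum.swap)
  also have "\<dots> = (\<Sum>j=1..N. 3 * (real j)\<^sup>2 * real (card {z\<in>Z. j \<le> r z}))"
    using assms(1) by (intro sum.cong refl) (simp add: sum.If_cases Int_def)
  also have "\<dots> \<le> (\<Sum>j=1..N. 3 * (real j)\<^sup>2 * (V / real j ^ 3))"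
    using level by (intro sum_mono mult_left_mono) auto
  also have "\<dots> = (\<Sum>j=1..N. 3 * V * inverse (real j))"
    by (intro sum.cong refl) (auto simp: power2_eq_square power3_eq_cube field_simps)
  finally show ?thesis by (simp add: harm_def sum_distrib_left)
qed

text \<open>The hypothesis says that \<open>A\<close> is of Szemeredi--Trotter type.\<close>
lemma sumset_lower_bound:
  assumes "finite A" "A \<noteq> {}" and S: "S = (\<lambda>(a,b). a + b) ` (A \<times> A)"
    and level: "\<And>B j. finite B \<Longrightarrow> j \<ge> 1 \<Longrightarrow>
      real (card {z\<in>diffset A B. j \<le> rep A B z}) \<le> V * real (card A) * (real (card B))\<^sup>2 / real j ^ 3"
  shows "real (card A) ^ 14 \<le> real (card S) ^ 9 * (3 * V * harm (card A)) ^ 5"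
proof -
  define N G s where "N = real (card A)" and "G = 3 * V * harm (card A)" and "s = real (card S)"
  have finS: "finite S" using assms by simp
  have Npos: "0 < N" using assms by (simp add: N_def card_gt_0_iff)
  have E3: "real (\<Sum>z\<in>diffset A B. rep A B z ^ 3) \<le> G * N * (real (card B))\<^sup>2" if "finite B" for B
    using sum_cubes_le_harm[OF finite_diffset[OF assms(1) that] rep_le_card[OF assms(1) that] level[OF that]]
    by (simp add: G_def N_def mult_ac)
  define E2 E3 EAS where "E2 = real (\<Sum>z\<in>diffset A A. (rep A A z)\<^sup>2)"
    and "E3 = real (\<Sum>z\<in>diffset A A. rep A A z ^ 3)" and "EAS = real (\<Sum>z\<in>diffset A S. (rep A S z)\<^sup>2)"
  have nn: "0 \<le> E2" "0 \<le> E3" "0 \<le> EAS" "0 \<le> s"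
    unfolding E2_def E3_def EAS_def s_def by (rule of_nat_0_le_iff)+
  have e3: "E3 \<le> G * N ^ 3"
    using E3[OF assms(1)] by (simp add: E3_def N_def power2_eq_square power3_eq_cube mult_ac)
  \<comment> \<open>Cauchy--Schwarz places the second moment between the third and the first, and
    the first is exactly \<open>N * s\<close>.\<close>
  have eas: "EAS\<^sup>2 \<le> G * N\<^sup>2 * s ^ 3"
  proof -
    let ?r = "\<lambda>z. sqrt (real (rep A S z))"
    have "EAS = (\<Sum>z\<in>diffset A S. ?r z * ?r z ^ 3)"
    proof -
      have "y * y ^ 3 = (y\<^sup>2)\<^sup>2" for y :: real by (simp add: power2_eq_square power3_eq_cube)
      then have "?r z * ?r z ^ 3 = (real (rep A S z))\<^sup>2" for z
        by (simp only: real_sqrt_pow2 of_nat_0_le_iff)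
      then show ?thesis by (simp add: EAS_def)
    qed
    then have "EAS\<^sup>2 \<le> (\<Sum>z\<in>diffset A S. (?r z)\<^sup>2) * (\<Sum>z\<in>diffset A S. (?r z ^ 3)\<^sup>2)"
      by (simp only: Cauchy_Schwarz_ineq_sum)
    also have "\<dots> = real (\<Sum>z\<in>diffset A S. rep A S z) * real (\<Sum>z\<in>diffset A S. rep A S z ^ 3)"
    proof -
      have "(y ^ 3)\<^sup>2 = (y\<^sup>2) ^ 3" for y :: real by (simp flip: power_mult)
      then have "(?r z ^ 3)\<^sup>2 = real (rep A S z) ^ 3" for z
        by (simp only: real_sqrt_pow2 of_nat_0_le_iff)
      then show ?thesis by simp
    qed
    also have "\<dots> \<le> (N * s) * (G * N * s\<^sup>2)"
      using E3[OF finS] unfolding sum_rep[OF assms(1) finS]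
      by (simp add: N_def s_def mult_left_mono)
    finally show ?thesis by (simp add: power2_eq_square power3_eq_cube mult_ac)
  qed
  have e2: "N ^ 4 \<le> s * E2"
    using card_power4_le_energy[OF assms(1)] unfolding N_def s_def E2_def S
    by (simp only: of_nat_mult[symmetric] of_nat_power[symmetric] of_nat_le_iff)
  have main: "E2 ^ 3 * N\<^sup>2 \<le> E3\<^sup>2 * EAS"
    using energy_cubed_le[OF assms(1) S] by (simp only: E2_def E3_def EAS_def N_def)
  have "N ^ 14 = (N ^ 4) ^ 3 * N\<^sup>2" by (simp flip: power_mult power_add)
  also have "\<dots> \<le> (s * E2) ^ 3 * N\<^sup>2"
    using e2 Npos by (intro mult_right_mono power_mono) auto
  also have "\<dots> = s ^ 3 * (E2 ^ 3 * N\<^sup>2)" by (simp add: power_mult_distrib mult_ac)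
  also have "\<dots> \<le> s ^ 3 * (E3\<^sup>2 * EAS)" using main nn by (intro mult_left_mono) auto
  \<comment> \<open>Only the square of \<open>EAS\<close> is bounded, so the inequality is squared;
    the bounds then bring in a factor \<open>N ^ 14\<close> that cancels.\<close>
  finally have "(N ^ 14)\<^sup>2 \<le> (s ^ 3 * (E3\<^sup>2 * EAS))\<^sup>2" using Npos by (intro power_mono) auto
  also have "\<dots> = s ^ 6 * (E3 ^ 4 * EAS\<^sup>2)" by (simp add: power_mult_distrib flip: power_mult)
  also have "\<dots> \<le> s ^ 6 * ((G * N ^ 3) ^ 4 * (G * N\<^sup>2 * s ^ 3))"
    using e3 eas nn by (intro mult_left_mono mult_mono power_mono) auto
  also have "\<dots> = (s ^ 9 * G ^ 5) * N ^ 14"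
    by (simp add: power_mult_distrib eval_nat_numeral mult_ac)
  finally have "N ^ 14 * N ^ 14 \<le> (s ^ 9 * G ^ 5) * N ^ 14" by (simp add: power2_eq_square)
  then have "N ^ 14 \<le> s ^ 9 * G ^ 5"
    by (rule mult_right_le_imp_le) (use Npos in simp)
  then show ?thesis by (simp only: N_def G_def s_def)
qed

section \<open>Quaternions\<close>

lemmas quat_ops = zero_quat_def one_quat_def plus_quat_def times_quat_def

instantiation quat :: ring_1_no_zero_divisors
begin
definition uminus_quat_def: "- x = Quat (- Re x) (- Im1 x) (- Im2 x) (- Im3 x)"
definition minus_quat_def: "x - y = x + - (y :: quat)"

text \<open>Euler's four-square identity. It excludes zero divisors and makes left multiplications
  similarities.\<close>

lemma quat_norm_mult:
  "(Re (x * y))\<^sup>2 + (Im1 (x * y))\<^sup>2 + (Im2 (x * y))\<^sup>2 + (Im3 (x * y))\<^sup>2 =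
   ((Re x)\<^sup>2 + (Im1 x)\<^sup>2 + (Im2 x)\<^sup>2 + (Im3 x)\<^sup>2) * ((Re y)\<^sup>2 + (Im1 y)\<^sup>2 + (Im2 y)\<^sup>2 + (Im3 y)\<^sup>2)"
  by (simp add: times_quat_def power2_eq_square) algebra

lemma quat_norm_eq_0: "(Re x)\<^sup>2 + (Im1 x)\<^sup>2 + (Im2 x)\<^sup>2 + (Im3 x)\<^sup>2 = 0 \<longleftrightarrow> x = 0"
  by (cases x) (auto simp: zero_quat_def add_nonneg_eq_0_iff)

instance
proof
  fix a b c :: quat
  show "a * b * c = a * (b * c)" by (simp add: quat_ops algebra_simps)
  show "a \<noteq> 0 \<Longrightarrow> b \<noteq> 0 \<Longrightarrow> a * b \<noteq> 0"
    by (metis quat_norm_mult quat_norm_eq_0 mult_eq_0_iff)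
qed (auto simp: quat_ops uminus_quat_def minus_quat_def algebra_simps intro: quat.expand)
end

text \<open>The iterated product type is a Euclidean space, from which the quaternions inherit their
  norm, their metric and the kissing bound.\<close>

definition quat_vec :: "quat \<Rightarrow> real \<times> real \<times> real \<times> real" where
  "quat_vec x = (Re x, Im1 x, Im2 x, Im3 x)"

lemma inj_quat_vec: "inj quat_vec"
  by (auto simp: inj_def quat_vec_def intro: quat.expand)

lemma quat_vec_diff: "quat_vec (x - y) = quat_vec x - quat_vec y"
  by (simp add: quat_vec_def minus_quat_def uminus_quat_def plus_quat_def)

lemma norm_quat_vec_mult: "norm (quat_vec (x * y)) = norm (quat_vec x) * norm (quat_vec y)"
  using quat_norm_mult[of x y]
  by (simp add: quat_vec_def norm_prod_def real_sqrt_mult[symmetric] add.assoc)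

instantiation quat :: metric_space
begin
definition dist_quat_def: "dist x y = norm (quat_vec (x - y))"
definition uniformity_quat_def:
  "(uniformity :: (quat \<times> quat) filter) = (INF e\<in>{0<..}. principal {(x, y). dist x y < e})"
definition open_quat_def:
  "open (U :: quat set) \<longleftrightarrow> (\<forall>x\<in>U. eventually (\<lambda>(x', y). x' = x \<longrightarrow> y \<in> U) uniformity)"

instance
proof
  fix x y z :: quat
  show "dist x y = 0 \<longleftrightarrow> x = y"
    using inj_quat_vec by (simp add: dist_quat_def quat_vec_diff inj_eq)
  show "dist x y \<le> dist x z + dist y z"
    unfolding dist_quat_def quat_vec_diff dist_norm[symmetric] by (rule dist_triangle2)
qed (simp_all add: uniformity_quat_def open_quat_def)
end

lemma dist_quat_vec: "dist (quat_vec x) (quat_vec y) = dist x y"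
  by (simp add: dist_quat_def quat_vec_diff dist_norm)

lemma dist_quat_mult_left: "dist (r * x) (r * y) = norm (quat_vec r) * dist x (y :: quat)"
  by (simp add: dist_quat_def right_diff_distrib[symmetric] norm_quat_vec_mult)

lemma kissing_bound_quat: "\<exists>K. kissing_bound TYPE(quat) K"
proof -
  obtain K where K: "kissing_bound TYPE(real \<times> real \<times> real \<times> real) K"
    using ex_kissing_bound by blast
  have "card {x\<in>Z. \<forall>y\<in>Z. y \<noteq> x \<longrightarrow> dist p x \<le> dist x y} \<le> K" if "finite Z" for Z and p :: quat
  proof -
    have "card {x\<in>Z. \<forall>y\<in>Z. y \<noteq> x \<longrightarrow> dist p x \<le> dist x y} =
        card (quat_vec ` {x\<in>Z. \<forall>y\<in>Z. y \<noteq> x \<longrightarrow> dist p x \<le> dist x y})"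
      by (intro card_image[symmetric] inj_on_subset[OF inj_quat_vec]) auto
    also have "\<dots> \<le> card {x\<in>quat_vec`Z. \<forall>y\<in>quat_vec`Z. y \<noteq> x \<longrightarrow> dist (quat_vec p) x \<le> dist x y}"
      using that by (intro card_mono) (auto simp: dist_quat_vec)
    also have "\<dots> \<le> K"
      using K that unfolding kissing_bound_def by blast
    finally show ?thesis .
  qed
  then show ?thesis unfolding kissing_bound_def by blast
qed

text \<open>Each representation \<open>a = s + b\<close> with \<open>a \<in> A\<close> yields \<open>t\<close> solutions of \<open>q = r (s + b)\<close>, that is,
  incidences of the points \<open>D \<times> Q\<close> with the lines \<open>s \<mapsto> r (s + b)\<close>.\<close>
lemma card_popular_diffset_le:
  assumes K: "kissing_bound TYPE(quat) K"
    and A: "finite A" "A \<noteq> {}" "0 \<notin> A" and B: "finite B" and j: "1 \<le> j" and t: "0 < t"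
    and QR: "finite Q" "finite R" "0 \<notin> R" "card A \<le> max (card Q) (card R)"
    and rich: "\<And>x. x \<in> A \<Longrightarrow> t \<le> real (card (Q \<inter> rtrans R x))"
  shows "real (card {z\<in>diffset A B. j \<le> rep A B z}) \<le>
     (256 * (real K)\<^sup>2) * ((real (card Q))\<^sup>2 * (real (card R))\<^sup>2 / (real (card A) * t ^ 3)) *
       real (card A) * (real (card B))\<^sup>2 / real j ^ 3"
proof (cases "{z\<in>diffset A B. j \<le> rep A B z} = {}")
  case True
  show ?thesis unfolding True using t by simp
next
  case False
  define D where "D = {z\<in>diffset A B. j \<le> rep A B z}"
  \<comment> \<open>A line is indexed by a pair \<open>(r, b)\<close>, so there are
    \<open>card R * card B\<close> of them.\<close>
  define f where "f = (\<lambda>(r, b) s. r * (s + b :: quat))"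
  define I where "I = (\<Sum>l\<in>R \<times> B. real (card {s\<in>D. f l s \<in> Q}))"
  have finD: "finite D" using A(1) B by (simp add: D_def)
  have Dpos: "0 < real (card D)" using False finD unfolding D_def[symmetric] by (simp add: card_gt_0_iff)
  have Apos: "0 < real (card A)" using A by (simp add: card_gt_0_iff)
  have rich': "t \<le> real (card {r\<in>R. r * x \<in> Q})" if "x \<in> A" for x
  proof -
    have "Q \<inter> rtrans R x = (\<lambda>r. r * x) ` {r\<in>R. r * x \<in> Q}" by (auto simp: rtrans_def)
    then have "card (Q \<inter> rtrans R x) \<le> card {r\<in>R. r * x \<in> Q}"
      using QR(2) by (simp add: card_image_le)
    then show ?thesis using rich[OF that] by linarith
  qed
  have I_ge: "real (card D) * (real j * t) \<le> I"
  proof -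
    have "real (card D) * (real j * t) = (\<Sum>s\<in>D. real j * t)" by simp
    also have "\<dots> \<le> (\<Sum>s\<in>D. real (card {l\<in>R \<times> B. f l s \<in> Q}))"
    proof (rule sum_mono)
      fix s assume "s \<in> D"
      then have "real j * t \<le> real (card {b\<in>B. s + b \<in> A}) * t"
        using t by (simp add: D_def rep_eq_card)
      also have "\<dots> = (\<Sum>b\<in>{b\<in>B. s + b \<in> A}. t)" by simp
      also have "\<dots> \<le> (\<Sum>b\<in>{b\<in>B. s + b \<in> A}. real (card {r\<in>R. r * (s + b) \<in> Q}))"
        using rich' by (intro sum_mono) auto
      also have "\<dots> = real (card (SIGMA b:{b\<in>B. s + b \<in> A}. {r\<in>R. r * (s + b) \<in> Q}))"
        using B QR by (subst card_SigmaI) auto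
      also have "\<dots> \<le> real (card {l\<in>R \<times> B. f l s \<in> Q})"
        unfolding of_nat_le_iff using B QR
        by (intro card_inj_on_le[of prod.swap]) (auto simp: f_def)
      finally show "real j * t \<le> real (card {l\<in>R \<times> B. f l s \<in> Q})" .
    qed
    also have "\<dots> = real (\<Sum>s\<in>D. card {l\<in>R \<times> B. f l s \<in> Q})" by simp
    also have "(\<Sum>s\<in>D. card {l\<in>R \<times> B. f l s \<in> Q}) = (\<Sum>l\<in>R \<times> B. card {s\<in>D. f l s \<in> Q})"
      using finD B QR by (intro sum_card_swap) auto
    finally show ?thesis by (simp add: I_def)
  qed
  have "real (card D) * (real j * t) ^ 3 \<le> (256 * (real K)\<^sup>2) * ((real (card Q))\<^sup>2 * (real (card R))\<^sup>2 * (real (card B))\<^sup>2)"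
  proof (cases "4 * real (card (R \<times> B)) \<le> I")
    case True
    have "I ^ 3 \<le> 256 * (real K)\<^sup>2 * (real (card D))\<^sup>2 * (real (card Q))\<^sup>2 * (real (card (R \<times> B)))\<^sup>2"
    proof (rule cartesian_incidence_bound[OF K finD QR(1) _ _ _ I_def True])
      show "finite (R \<times> B)" using QR B by simp
      show "\<exists>c>0. \<forall>x y. dist (f l x) (f l y) = c * dist x y" if "l \<in> R \<times> B" for l
      proof -
        obtain r b where l: "l = (r, b)" by (cases l)
        then have "r \<noteq> 0" using that QR(3) by auto
        have "dist r 0 > 0" using \<open>r \<noteq> 0\<close> by simp
        then have "0 < norm (quat_vec r)" by (simp add: dist_quat_def)
        moreover have "dist (x + b) (y + b) = dist x y" for x y by (simp add: dist_quat_def)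
        ultimately show ?thesis
          by (intro exI[of _ "norm (quat_vec r)"]) (simp add: f_def l dist_quat_mult_left)
      qed
      show "l = m" if lm: "l \<in> R \<times> B" "m \<in> R \<times> B" and xy: "x \<noteq> y" "f l x = f m x" "f l y = f m y" for l m x y
      proof -
        obtain r b r' b' where l: "l = (r, b)" "m = (r', b')" by (cases l, cases m) auto
        \<comment> \<open>Subtracting the two incidence equations removes \<open>b\<close> and
          \<open>b'\<close>; without zero divisors this forces \<open>r = r'\<close>, and cancelling
          \<open>r\<close> then gives \<open>b = b'\<close>.\<close>
        have "(r - r') * (x - y) = (r * (x + b) - r' * (x + b')) - (r * (y + b) - r' * (y + b'))"
          by (simp add: algebra_simps)
        also have "\<dots> = 0" using xy by (simp add: f_def l)
        finally have "r = r'" using xy(1) by simp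
        then show ?thesis using xy(2) lm QR(3) by (auto simp: f_def l)
      qed
    qed
    moreover have "(real (card D) * (real j * t)) ^ 3 \<le> I ^ 3"
      using I_ge t by (intro power_mono) auto
    \<comment> \<open>\<open>card D\<close> enters cubed on the left and squared on the right, so
      its square cancels.\<close>
    ultimately have "(real (card D))\<^sup>2 * (real (card D) * (real j * t) ^ 3) \<le>
        (real (card D))\<^sup>2 * ((256 * (real K)\<^sup>2) * ((real (card Q))\<^sup>2 * (real (card R))\<^sup>2 * (real (card B))\<^sup>2))"
      by (simp add: card_cartesian_product power_mult_distrib power2_eq_square power3_eq_cube mult_ac)
    then show ?thesis using Dpos by simp
  next
    \<comment> \<open>With few incidences, \<open>I_ge\<close> bounds one factor
      \<open>card D * j * t\<close> by 4 times the number of lines; trivial bounds on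
      \<open>j\<close> and \<open>t\<close> handle the remaining square of
      \<open>j * t\<close>.\<close>
    case False
    have "D \<noteq> {}" using Dpos by auto
    then obtain s where s: "s \<in> D" by blast
    have "j \<le> rep A B s" using s by (simp add: D_def)
    moreover have "rep A B s \<le> card B" unfolding rep_eq_card using B by (intro card_mono) auto
    ultimately have jA: "real j \<le> real (card A)" and jB: "real j \<le> real (card B)"
      using rep_le_card[OF A(1) B, of s] by auto
    obtain a where "a \<in> A" using A(2) by blast
    have "card (Q \<inter> rtrans R a) \<le> card Q" using QR by (intro card_mono) auto
    moreover have "card (Q \<inter> rtrans R a) \<le> card R"
      using QR by (intro order.trans[OF card_mono card_image_le[of R "\<lambda>r. r * a"]]) (auto simp: rtrans_def)
    ultimately have tQ: "t \<le> real (card Q)" and tR: "t \<le> real (card R)"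
      using rich[OF \<open>a \<in> A\<close>] by auto
    \<comment> \<open>The larger of \<open>card Q\<close> and \<open>card R\<close> absorbs
      \<open>card A\<close>, and each factor \<open>t\<close> is at most one of the two remaining
      cardinalities.\<close>
    have "real (card A) * (t * t) \<le> real (card Q) * (real (card Q) * real (card R))"
    proof (cases "card A \<le> card Q")
      case True
      then show ?thesis using t tQ tR by (intro mult_mono) auto
    next
      case False
      then have "real (card A) \<le> real (card R)" using QR(4) by auto
      then have "real (card A) * (t * t) \<le> real (card R) * (real (card Q) * real (card Q))"
        using t tQ by (intro mult_mono) auto
      then show ?thesis by (simp add: mult_ac)
    qed
    then have "real (card B) * (real (card A) * (t * t)) \<le> real (card B) * (real (card Q) * (real (card Q) * real (card R)))"
      by (rule mult_left_mono) simp
    moreover have "(real j * real j) * (t * t) \<le> (real (card B) * real (card A)) * (t * t)"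
      using jA jB t by (intro mult_mono) auto
    ultimately have jt: "(real j * t)\<^sup>2 \<le> (real (card Q))\<^sup>2 * real (card R) * real (card B)"
      by (simp add: power2_eq_square mult_ac)
    have K1: "4 \<le> 256 * (real K)\<^sup>2"
    proof -
      have "1 \<le> real K" using kissing_bound_pos[OF K] by simp
      then have "1 \<le> (real K)\<^sup>2" by (rule one_le_power)
      then show ?thesis by simp
    qed
    have "real (card D) * (real j * t) ^ 3 = (real (card D) * (real j * t)) * (real j * t)\<^sup>2"
      by (simp add: power2_eq_square power3_eq_cube)
    also have "\<dots> \<le> (4 * (real (card R) * real (card B))) * ((real (card Q))\<^sup>2 * real (card R) * real (card B))"
      using I_ge False by (intro mult_mono[OF _ jt]) (auto simp: card_cartesian_product)
    also have "\<dots> = 4 * ((real (card Q))\<^sup>2 * (real (card R))\<^sup>2 * (real (card B))\<^sup>2)"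
      by (simp add: power2_eq_square mult_ac)
    also have "\<dots> \<le> (256 * (real K)\<^sup>2) * ((real (card Q))\<^sup>2 * (real (card R))\<^sup>2 * (real (card B))\<^sup>2)"
      using K1 by (rule mult_right_mono) auto
    finally show ?thesis .
  qed
  then have "real (card D) \<le> (256 * (real K)\<^sup>2) * ((real (card Q))\<^sup>2 * (real (card R))\<^sup>2 * (real (card B))\<^sup>2) / (real j * t) ^ 3"
    using j t by (subst pos_le_divide_eq) auto
  also have "\<dots> = (256 * (real K)\<^sup>2) * ((real (card Q))\<^sup>2 * (real (card R))\<^sup>2 / (real (card A) * t ^ 3)) *
       real (card A) * (real (card B))\<^sup>2 / real j ^ 3"
    using Apos j t by (simp add: power_mult_distrib field_simps)
  finally show ?thesis by (simp add: D_def)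
qed

text \<open>\<open>Q = A\<close>, \<open>R = {1}\<close>, \<open>t = 1\<close> is admissible, since
  \<open>A\<close> meets \<open>{x}\<close> in one point for each \<open>x\<close> in
  \<open>A\<close>. This makes the infimum meaningful.\<close>

lemma dstar_vals_nonempty:
  assumes "finite A" "A \<noteq> {}" "0 \<notin> A"
  shows "dstar_vals A \<noteq> {}"
proof -
  have "(real (card A))\<^sup>2 * (real (card {1::quat}))\<^sup>2 / (real (card A) * 1 ^ 3) \<in> dstar_vals A"
    unfolding dstar_vals_def mem_Collect_eq using assms
    by (intro exI[of _ "1::real"] exI[of _ A] exI[of _ "{1}"] conjI refl) (auto simp: rtrans_def)
  then show ?thesis by blast
qed

text \<open>The count divided by \<open>c\<close> is a lower bound for every admissible value, hence
  for their infimum. Empty \<open>B\<close> is treated apart to keep \<open>c\<close>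
  positive.\<close>

lemma card_popular_diffset_le_dstar:
  assumes K: "kissing_bound TYPE(quat) K"
    and A: "finite A" "A \<noteq> {}" "0 \<notin> A" and B: "finite B" and j: "1 \<le> j"
  shows "real (card {z\<in>diffset A B. j \<le> rep A B z}) \<le>
     (256 * (real K)\<^sup>2 * dstar A) * real (card A) * (real (card B))\<^sup>2 / real j ^ 3"
proof (cases "B = {}")
  case True
  then show ?thesis by (simp add: diffset_def)
next
  case False
  define c where "c = (256 * (real K)\<^sup>2) * real (card A) * (real (card B))\<^sup>2 / real j ^ 3"
  have c: "0 < c"
    using A B False j kissing_bound_pos[OF K] by (auto simp: c_def card_gt_0_iff)
  have "real (card {z\<in>diffset A B. j \<le> rep A B z}) / c \<le> dstar A"
    unfolding dstar_def
  proof (rule cInf_greatest[OF dstar_vals_nonempty[OF A]])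
    fix v assume "v \<in> dstar_vals A"
    then obtain t Q R where v: "v = (real (card Q))\<^sup>2 * (real (card R))\<^sup>2 / (real (card A) * t ^ 3)"
      and tQR: "t > 0" "finite Q" "finite R" "0 \<notin> R" "card A \<le> max (card Q) (card R)"
        "\<And>x. x \<in> A \<Longrightarrow> t \<le> real (card (Q \<inter> rtrans R x))"
      unfolding dstar_vals_def by blast
    have "real (card {z\<in>diffset A B. j \<le> rep A B z}) \<le>
        (256 * (real K)\<^sup>2) * v * real (card A) * (real (card B))\<^sup>2 / real j ^ 3"
      unfolding v by (rule card_popular_diffset_le[OF K A B j tQR])
    also have "\<dots> = c * v" by (simp add: c_def)
    finally show "real (card {z\<in>diffset A B. j \<le> rep A B z}) / c \<le> v"
      using c by (simp add: field_simps)
  qed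
  then have "real (card {z\<in>diffset A B. j \<le> rep A B z}) \<le> dstar A * c"
    using c by (simp only: pos_divide_le_eq)
  then show ?thesis by (simp add: c_def mult_ac)
qed

section \<open>Harmonic numbers and the final exponents\<close>

lemma harm_le_ln:
  assumes "2 \<le> n"
  shows "harm n \<le> 3 * ln (real n)"
proof -
  have "harm n \<le> ln (real n) + (1::real)"
    using euler_mascheroni_sequence_decreasing[of 1 n] assms by (simp add: harm_expand)
  \<comment> \<open>From \<open>n = 2\<close> on, 1 is at most 2 ln n, which yields the factor
    3.\<close>
  moreover have "1/2 \<le> ln (2::real)" using ln2_ge_two_thirds by simp
  moreover have "ln 2 \<le> ln (real n)" using assms by simp
  ultimately show ?thesis by linarith
qed

lemma sumset_conv_image: "sumset A B = (\<lambda>(a, b). a + b) ` (A \<times> B)"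
  by (auto simp: sumset_def)

theorem theorem3p7:
  shows "\<exists>c::real. c \<ge> 0 \<and> (\<forall>\<epsilon>::real. \<epsilon> > 0 \<longrightarrow> (\<exists>c\<epsilon>::real. c\<epsilon> > 0 \<and>
    (\<forall>A::quat set. finite A \<and> A \<noteq> {} \<and> 0 \<notin> A \<longrightarrow>
      real (card (sumset A A)) \<ge>
        c\<epsilon> * real (card A) powr (14/9 - \<epsilon>) /
          (dstar A powr (5/9) * ln (real (card A)) powr c))))"
proof -
  obtain K where K: "kissing_bound TYPE(quat) K" using kissing_bound_quat by blast
  \<comment> \<open>The 9 is 3 from the summation of cubes times 3 from
    \<open>harm_le_ln\<close>.\<close>
  define C where "C = 9 * (256 * (real K)\<^sup>2)"
  have C: "0 < C" using kissing_bound_pos[OF K] by (simp add: C_def)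
  have bound: "C powr (-5/9) * real (card A) powr (14/9 - \<epsilon>) /
          (dstar A powr (5/9) * ln (real (card A)) powr (5/9)) \<le> real (card (sumset A A))"
    if A: "finite A" "A \<noteq> {}" "0 \<notin> A" and \<epsilon>: "\<epsilon> > 0" for A and \<epsilon> :: real
  proof (cases "2 \<le> card A \<and> dstar A \<noteq> 0")
    \<comment> \<open>The left side is 0 here: \<open>ln 1 = 0\<close>,
      \<open>0 powr (5/9) = 0\<close>, and division by 0 gives 0.\<close>
    case False
    have "card A \<noteq> 0" using A by simp
    with False have "card A = 1 \<or> dstar A = 0" by linarith
    then show ?thesis by auto
  next
    case True
    define N d l s where "N = real (card A)" and "d = dstar A" and "l = ln N" and "s = real (card (sumset A A))"
    have N: "2 \<le> N" using True by (simp add: N_def)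
    have l: "0 < l" using N by (simp add: l_def)
    have "0 \<le> d" unfolding d_def dstar_def
      using dstar_vals_nonempty[OF A] by (intro cInf_greatest) (auto simp: dstar_vals_def)
    then have d: "0 < d" using True by (simp add: d_def)
    have s0: "0 \<le> s" by (simp add: s_def)
    have "N ^ 14 \<le> s ^ 9 * (3 * (256 * (real K)\<^sup>2 * dstar A) * harm (card A)) ^ 5"
      unfolding N_def s_def
      by (rule sumset_lower_bound[OF A(1,2) sumset_conv_image card_popular_diffset_le_dstar[OF K A]])
    also have "\<dots> \<le> s ^ 9 * (C * d * l) ^ 5"
    proof (intro mult_left_mono power_mono)
      have "(3 * (256 * (real K)\<^sup>2 * d)) * harm (card A) \<le> (3 * (256 * (real K)\<^sup>2 * d)) * (3 * l)"
        using harm_le_ln[of "card A"] True d by (intro mult_left_mono) (auto simp: l_def N_def)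
      then show "3 * (256 * (real K)\<^sup>2 * dstar A) * harm (card A) \<le> C * d * l"
        by (simp add: C_def d_def mult_ac)
    qed (use d s0 in \<open>auto simp: d_def harm_nonneg\<close>)
    finally have le: "N ^ 14 \<le> s ^ 9 * (C * d * l) ^ 5" .
    have pos: "0 < C * d * l" using C d l by simp
    have s: "0 < s"
    proof (rule ccontr)
      assume "\<not> 0 < s"
      then have "s = 0" using s0 by simp
      then show False using le N by simp
    qed
    have root: "(x ^ n) powr (1/9) = x powr (real n / 9)" if "0 < x" for x n
      unfolding powr_realpow[OF that, symmetric] powr_powr by simp
    have "N powr (14/9) = (N ^ 14) powr (1/9)"
      using root[of N 14] N by simp
    also have "\<dots> \<le> (s ^ 9 * (C * d * l) ^ 5) powr (1/9)"
      using le N by (intro powr_mono2) auto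
    also have "\<dots> = (s ^ 9) powr (1/9) * ((C * d * l) ^ 5) powr (1/9)"
      by (rule powr_mult)
    also have "\<dots> = s * (C * d * l) powr (5/9)"
      using root[of s 9] root[of "C * d * l" 5] s pos by simp
    also have "\<dots> = s * (C powr (5/9) * (d powr (5/9) * l powr (5/9)))"
      using C d l by (simp add: powr_mult mult.assoc)
    finally have main: "N powr (14/9) \<le> s * (C powr (5/9) * (d powr (5/9) * l powr (5/9)))" .
    \<comment> \<open>The estimate holds without loss in the exponent; since
      \<open>N \<ge> 1\<close>, subtracting \<epsilon> only weakens it, and the constant does not
      depend on \<epsilon>.\<close>
    have "N powr (14/9 - \<epsilon>) \<le> N powr (14/9)" using N \<epsilon> by (intro powr_mono) auto
    then have "C powr (-5/9) * N powr (14/9 - \<epsilon>) \<le>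
        C powr (-5/9) * (s * (C powr (5/9) * (d powr (5/9) * l powr (5/9))))"
      using main by (intro mult_left_mono) auto
    also have "\<dots> = (C powr (-5/9) * C powr (5/9)) * (s * (d powr (5/9) * l powr (5/9)))"
      by (simp only: mult_ac)
    also have "C powr (-5/9) * C powr (5/9) = 1"
      using C by (simp flip: powr_add)
    finally have "C powr (-5/9) * N powr (14/9 - \<epsilon>) / (d powr (5/9) * l powr (5/9)) \<le> s"
      using d l by (simp add: divide_le_eq)
    then show ?thesis by (simp add: N_def d_def l_def s_def)
  qed
  then show ?thesis
    using C by (intro exI[of _ "5/9"] conjI allI impI exI[of _ "C powr (-5/9)"]) auto
qed

end
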